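(* Let $q\in\mathbb{C}$ with $0<|q|<1$. Let $f(a,b,c)$ be a function of three complex variables that is analytic in a neighborhood of $(a,b,c)=(0,0,0)\in\mathbb{C}^3$ and satisfies there the $q$-functional equation $$c\big(f(a,b,c)-f(a,bq,c)\big)=b\big(f(a,b,c)-f(a,b,cq)-af(a,bq,c)+af(a,bq,cq)\big).$$ Then, for $(a,b,c)$ near $(0,0,0)$, $$f(a,b,c)=T(a,b;D_q)\{f(a,0,c)\}=\sum_{n=0}^{\infty}\frac{(a;q)_n}{(q;q)_n}\,b^n\,D_q^n\{f(a,0,c)\},$$ where $D_q$ (and hence $T(a,b;D_q)$) acts with respect to the variable $c$.
   Context: The $q$-shifted factorials are $(a;q)_0=1$ and $(a;q)_n=(1-a)(1-aq)\cdots(1-aq^{n-1})$ for $n\ge 1$. The $q$-derivative operator, acting on a function $g$ of the variable $c$, is $D_q\{g(c)\}=\dfrac{g(c)-g(cq)}{c}$ (with no factor $1-q$ in the denominator), with $D_q^0$ the identity and $D_q^n\{g(c)\}=D_q\{D_q^{n-1}\{g(c)\}\}$. For $g$ analytic near $0$, the removable singularity of $D_q\{g\}$ at $c=0$ is filled in; thus $D_q\{c^k\}=(1-q^k)c^{k-1}$ for $k\ge 1$ and $D_q\{1\}=0$. The operator $T(a,b;D_q)=\sum_{n\ge0}\frac{(a;q)_n}{(q;q)_n}(bD_q)^n$ acts on a function $g(c)$ by $T(a,b;D_q)\{g(c)\}=\sum_{n\ge 0}\frac{(a;q)_n}{(q;q)_n}b^n D_q^n\{g(c)\}$; here $a$ and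 $b$ are treated as constants. *)

theory Defs
  imports "HOL-Analysis.Analysis"
begin

definition qpoch :: "complex \<Rightarrow> complex \<Rightarrow> nat \<Rightarrow> complex" where
  "qpoch a q n = (\<Prod>k<n. 1 - a * q ^ k)"

(* The value at c = 0 fills in the removable singularity; it is meaningful only if the
   limit exists, in particular if g is analytic near 0. *)
definition Dq :: "complex \<Rightarrow> (complex \<Rightarrow> complex) \<Rightarrow> complex \<Rightarrow> complex" where
  "Dq q g c = (if c = 0 then Lim (at 0) (\<lambda>z. (g z - g (z * q)) / z)
               else (g c - g (c * q)) / c)"

definition T_op :: "complex \<Rightarrow> complex \<Rightarrow> complex \<Rightarrow> (complex \<Rightarrow> complex) \<Rightarrow> complex \<Rightarrow> complex" where
  "T_op q a b g c = (\<Sum>n. qpoch a q n / qpoch q q n * b ^ n * (Dq q ^^ n) g c)"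

(* Analyticity in three complex variables on an open set U: around each point of U the
   function is the (unconditionally, hence absolutely) convergent sum of a triple power
   series on some polydisc. *)
definition analytic3_on ::
  "(complex \<Rightarrow> complex \<Rightarrow> complex \<Rightarrow> complex) \<Rightarrow> (complex \<times> complex \<times> complex) set \<Rightarrow> bool" where
  "analytic3_on f U \<longleftrightarrow>
     (\<forall>(a0, b0, c0) \<in> U. \<exists>r>0. \<exists>A :: nat \<Rightarrow> nat \<Rightarrow> nat \<Rightarrow> complex.
        \<forall>a b c. norm (a - a0) < r \<and> norm (b - b0) < r \<and> norm (c - c0) < r \<longrightarrow>
          ((\<lambda>(i, j, k). A i j k * (a - a0) ^ i * (b - b0) ^ j * (c - c0) ^ k)
             has_sum f a b c) UNIV)"

lemma Dq_const: "Dq q (\<lambda>_. w) = (\<lambda>_. 0)"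
  by (auto simp: Dq_def fun_eq_iff intro!: tendsto_Lim)

lemma Dq_power: "Dq q (\<lambda>c. c ^ Suc k) = (\<lambda>c. (1 - q ^ Suc k) * c ^ k)"
proof
  fix c :: complex
  have quot: "(z ^ Suc k - (z * q) ^ Suc k) / z = (1 - q ^ Suc k) * z ^ k" if "z \<noteq> 0" for z
    using that by (simp add: field_simps power_mult_distrib)
  have "((\<lambda>z. (1 - q ^ Suc k) * z ^ k) \<longlongrightarrow> (1 - q ^ Suc k) * 0 ^ k) (at 0)"
    by (intro tendsto_intros)
  moreover have "\<forall>\<^sub>F z in at 0. (1 - q ^ Suc k) * z ^ k = (z ^ Suc k - (z * q) ^ Suc k) / z"
    using quot by (auto simp: eventually_at intro!: exI[of _ 1])
  ultimately have "((\<lambda>z. (z ^ Suc k - (z * q) ^ Suc k) / z) \<longlongrightarrow> (1 - q ^ Suc k) * 0 ^ k) (at 0)"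
    by (rule Lim_transform_eventually)
  then have "Lim (at 0) (\<lambda>z. (z ^ Suc k - (z * q) ^ Suc k) / z) = (1 - q ^ Suc k) * 0 ^ k"
    by (intro tendsto_Lim) auto
  then show "Dq q (\<lambda>c. c ^ Suc k) c = (1 - q ^ Suc k) * c ^ k"
    unfolding Dq_def using quot[of c] by (cases "c = 0") simp_all
qed

end

theory Submission
  imports Defs
begin

text \<open>
  For fixed \<open>a\<close>, expand \<open>f a b c = (\<Sum>n. h n c * b ^ n)\<close>. Comparing coefficients of \<open>b\<close> in the
  functional equation gives \<open>(1 - q ^ Suc n) * h (Suc n) = (1 - a * q ^ n) * Dq q (h n)\<close>, so
  \<open>h n\<close> is \<open>qpoch a q n / qpoch q q n\<close> times the \<open>n\<close>-th \<open>q\<close>-derivative of \<open>h 0 = f a 0\<close>.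
  The argument is run with \<open>norm a < 1\<close>, so that no factor \<open>1 - a * q ^ n\<close> vanishes: then
  the limit defining \<open>Dq q (h n) 0\<close> exists because \<open>h (Suc n)\<close> is continuous.
\<close>

lemma qpoch_nonzero:
  assumes "norm a < 1" and "norm q < 1"
  shows "qpoch a q n \<noteq> 0"
proof -
  have "1 - a * q ^ k \<noteq> 0" for k
  proof
    assume "1 - a * q ^ k = 0"
    then have "norm (a * q ^ k) = 1"
      by (metis eq_iff_diff_eq_0 norm_one)
    moreover have "norm (a * q ^ k) \<le> norm a * 1"
      unfolding norm_mult norm_power using assms by (intro mult_left_mono power_le_one) auto
    ultimately show False
      using assms by simp
  qed
  then show ?thesis
    by (simp add: qpoch_def)
qed

lemma norm_mult_less_left:
  fixes x q :: "'a :: real_normed_div_algebra"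
  assumes "norm x < r" and "norm q < 1"
  shows "norm (x * q) < r"
  using assms mult_left_le[of "norm q" "norm x"] by (simp add: norm_mult)

text \<open>Unconditional summability permits regrouping: with \<open>a\<close> fixed, summing over
  \<open>i\<close> first gives the coefficients \<open>g j k\<close>, and summing over
  \<open>k\<close> next leaves a power series in \<open>b\<close> whose coefficients are power
  series in \<open>c\<close>.\<close>

lemma has_sum_triple_power_series_slice:
  fixes A :: "nat \<Rightarrow> nat \<Rightarrow> nat \<Rightarrow> complex"
  assumes "r > 0" and a: "norm a < r"
    and series: "\<And>b c. norm b < r \<Longrightarrow> norm c < r \<Longrightarrow>
      ((\<lambda>(i, j, k). A i j k * a ^ i * b ^ j * c ^ k) has_sum f b c) UNIV"
  obtains g :: "nat \<Rightarrow> nat \<Rightarrow> complex" where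
    "\<And>j c. norm c < r \<Longrightarrow> summable (\<lambda>k. g j k * c ^ k)"
    "\<And>b c. norm b < r \<Longrightarrow> norm c < r \<Longrightarrow> (\<lambda>j. (\<Sum>k. g j k * c ^ k) * b ^ j) sums f b c"
proof -
  define g where "g j k = (\<Sum>\<^sub>\<infinity>i. A i j k * a ^ i)" for j k
  \<comment> \<open>A nonzero point of the disc: summability is read off with \<open>d\<close> in
    place of \<open>b\<close> (or of both \<open>b\<close> and \<open>c\<close>), and the fixed
    powers of \<open>d\<close> are then divided out.\<close>
  define d :: complex where "d = of_real (r / 2)"
  have d: "d \<noteq> 0" "norm d < r"
    using \<open>r > 0\<close> by (auto simp: d_def)
  have reindexed: "((\<lambda>((j, k), i). A i j k * a ^ i * (b ^ j * c ^ k)) has_sum f b c)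
      (UNIV \<times> UNIV)" if "norm b < r" "norm c < r" for b c
  proof -
    \<comment> \<open>The index \<open>i\<close> is moved to the innermost place, where the Sigma
      rules sum it first.\<close>
    have "bij (\<lambda>((j, k), i). (i, j, k))"
      by (rule bij_betwI[where g = "\<lambda>(i, j, k). ((j, k), i)"]) auto
    from has_sum_reindex_bij_betw[OF this, of "\<lambda>(i, j, k). A i j k * a ^ i * b ^ j * c ^ k" "f b c"]
    show ?thesis
      using series[OF that] by (simp add: case_prod_unfold mult.assoc)
  qed
  have inner: "((\<lambda>i. A i j k * a ^ i) has_sum g j k) UNIV" for j k
  proof -
    have "(\<lambda>((j, k), i). A i j k * a ^ i * (d ^ j * d ^ k)) summable_on (UNIV \<times> UNIV)"
      using reindexed[OF d(2) d(2)] by (rule has_sum_imp_summable)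
    from summable_on_SigmaD1[OF this, of "(j, k)"]
    have "(\<lambda>i. A i j k * a ^ i * (d ^ j * d ^ k)) summable_on UNIV"
      by simp
    then have "(\<lambda>i. A i j k * a ^ i) summable_on UNIV"
      using d by (subst (asm) summable_on_cmult_left') auto
    then show ?thesis
      by (simp add: g_def)
  qed
  have double: "((\<lambda>(j, k). g j k * (b ^ j * c ^ k)) has_sum f b c) (UNIV \<times> UNIV)"
    if "norm b < r" "norm c < r" for b c
  proof -
    have "((\<lambda>i. (\<lambda>((j, k), i). A i j k * a ^ i * (b ^ j * c ^ k)) (p, i))
        has_sum (\<lambda>(j, k). g j k * (b ^ j * c ^ k)) p) UNIV" for p
      using has_sum_cmult_left[OF inner] by (auto simp: case_prod_unfold)
    from has_sum_SigmaD[OF reindexed[OF that] this] show ?thesis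
      by simp
  qed
  have summable_on: "(\<lambda>k. g j k * c ^ k) summable_on UNIV" if "norm c < r" for j c
  proof -
    have "(\<lambda>(j, k). g j k * (d ^ j * c ^ k)) summable_on (UNIV \<times> UNIV)"
      using double[OF d(2) that] by (rule has_sum_imp_summable)
    from summable_on_SigmaD1[OF this, of j]
    have "(\<lambda>k. d ^ j * (g j k * c ^ k)) summable_on UNIV"
      by (simp add: mult_ac)
    then show ?thesis
      using d by (subst (asm) summable_on_cmult_right') auto
  qed
  have has_sum: "((\<lambda>k. g j k * c ^ k) has_sum (\<Sum>k. g j k * c ^ k)) UNIV"
    if "norm c < r" for j c
    using has_sum_infsum[OF summable_on[OF that]] has_sum_imp_sums sums_unique by metis
  show ?thesis
  proof
    fix j c
    assume "norm (c :: complex) < r"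
    then show "summable (\<lambda>k. g j k * c ^ k)"
      using has_sum has_sum_imp_sums sums_summable by blast
  next
    fix b c
    assume bc: "norm (b :: complex) < r" "norm (c :: complex) < r"
    have "((\<lambda>k. (\<lambda>(j, k). g j k * (b ^ j * c ^ k)) (j, k))
        has_sum (\<Sum>k. g j k * c ^ k) * b ^ j) UNIV" for j
      using has_sum_cmult_left[OF has_sum[OF bc(2)], where c = "b ^ j"] by (simp add: mult_ac)
    from has_sum_SigmaD[OF double[OF bc] this]
    show "(\<lambda>j. (\<Sum>k. g j k * c ^ k) * b ^ j) sums f b c"
      by (intro has_sum_imp_sums) simp
  qed
qed

text \<open>A function determines its power series expansion at 0, and the zero function has the
  zero series as expansion.\<close>

lemma powser_sums_0_imp_coeff_0:
  fixes u :: "nat \<Rightarrow> complex"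
  assumes "r > 0" and sums: "\<And>x. norm x < r \<Longrightarrow> (\<lambda>n. u n * x ^ n) sums 0"
  shows "u n = 0"
proof -
  have "\<forall>\<^sub>F x in nhds 0. x \<in> ball (0 :: complex) r"
    using \<open>r > 0\<close> by (intro eventually_nhds_in_open) auto
  then have "\<forall>\<^sub>F x in nhds 0. (\<lambda>n. fps_nth (Abs_fps u) n * x ^ n) sums 0"
    by eventually_elim (simp add: sums)
  then have "(\<lambda>_. 0) has_fps_expansion Abs_fps u"
    by (rule has_fps_expansionI)
  from fps_nth_fps_expansion[OF this] fps_nth_fps_expansion[OF has_fps_expansion_0] show ?thesis
    by (metis fps_nth_Abs_fps fps_zero_nth)
qed

text \<open>The points \<open>c\<close> and \<open>c * q\<close> both lie in the disc, and the limit
  at 0 depends only on values near 0. This allows \<open>Dq\<close> to be iterated on identities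
  known only on a disc.\<close>

lemma Dq_cong_disc:
  assumes "norm q < 1" and "norm c < r" and eq: "\<And>z. norm z < r \<Longrightarrow> g z = h z"
  shows "Dq q g c = Dq q h c"
proof (cases "c = 0")
  case True
  with assms(2) have "r > 0"
    by simp
  then have "\<forall>\<^sub>F z in at 0. norm z < r"
    by (auto simp: eventually_at dist_norm)
  then have "\<forall>\<^sub>F z in at 0. (g z - g (z * q)) / z = (h z - h (z * q)) / z"
    by eventually_elim (simp add: eq norm_mult_less_left[OF _ assms(1)])
  \<comment> \<open>\<open>Lim\<close> is a definite description, so having the same limits
    \<open>l\<close> suffices, even where no limit exists.\<close>
  then have "((\<lambda>z. (g z - g (z * q)) / z) \<longlongrightarrow> l) (at 0) \<longleftrightarrow>
      ((\<lambda>z. (h z - h (z * q)) / z) \<longlongrightarrow> l) (at 0)" for l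
    by (rule tendsto_cong)
  then show ?thesis
    using True by (simp add: Dq_def t2_space_class.Lim_def)
qed (simp add: Dq_def assms norm_mult_less_left)

text \<open>Off 0 the quotient equals \<open>h\<close>; at 0 the continuity of \<open>h\<close>
  supplies the limit that \<open>Dq\<close> takes.\<close>

lemma Dq_eqI_disc:
  assumes "norm c < r" and "isCont h 0"
    and quotient: "\<And>z. norm z < r \<Longrightarrow> g z - g (z * q) = z * h z"
  shows "Dq q g c = h c"
proof (cases "c = 0")
  case True
  with assms(1) have "r > 0"
    by simp
  have "(h \<longlongrightarrow> h 0) (at 0)"
    using assms(2) by (simp add: isCont_def)
  moreover have "\<forall>\<^sub>F z in at 0. h z = (g z - g (z * q)) / z"
    using \<open>r > 0\<close> quotient by (auto simp: eventually_at dist_norm intro!: exI[of _ r])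
  ultimately have "((\<lambda>z. (g z - g (z * q)) / z) \<longlongrightarrow> h 0) (at 0)"
    by (rule Lim_transform_eventually)
  then show ?thesis
    using True by (auto simp: Dq_def intro!: tendsto_Lim)
qed (simp add: Dq_def quotient[OF assms(1)])

text \<open>By \<open>rec\<close>, one application of \<open>Dq\<close> to \<open>h n\<close> gives
  \<open>h (Suc n)\<close> times \<open>(1 - q ^ Suc n) / (1 - a * q ^ n)\<close>; these factors
  accumulate to the quotient of the two q-shifted factorials.\<close>

lemma Dq_power_eq_coeff:
  fixes h :: "nat \<Rightarrow> complex \<Rightarrow> complex"
  assumes "norm q < 1" and "norm a < 1" and "norm c < r"
    and cont: "\<And>n. isCont (h n) 0"
    and rec: "\<And>n z. norm z < r \<Longrightarrow>
      z * ((1 - q ^ Suc n) * h (Suc n) z) = (1 - a * q ^ n) * (h n z - h n (z * q))"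
    and g: "\<And>z. norm z < r \<Longrightarrow> g z = h 0 z"
  shows "(Dq q ^^ n) g c = qpoch q q n / qpoch a q n * h n c"
  using \<open>norm c < r\<close>
proof (induction n arbitrary: c)
  case 0
  then show ?case
    by (simp add: qpoch_def g)
next
  case (Suc n)
  have Suc_a: "qpoch a q (Suc n) = qpoch a q n * (1 - a * q ^ n)"
    and Suc_q: "qpoch q q (Suc n) = qpoch q q n * (1 - q ^ Suc n)"
    by (simp_all add: qpoch_def)
  have nonzero: "1 - a * q ^ n \<noteq> 0" "qpoch a q n \<noteq> 0"
    using qpoch_nonzero[OF assms(2,1), of "Suc n"] Suc_a by auto
  have "(Dq q ^^ Suc n) g c = Dq q (\<lambda>z. qpoch q q n / qpoch a q n * h n z) c"
    using Dq_cong_disc[OF assms(1) Suc.prems Suc.IH] by simp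
  also have "\<dots> = qpoch q q (Suc n) / qpoch a q (Suc n) * h (Suc n) c"
  proof (rule Dq_eqI_disc[OF Suc.prems])
    show "isCont (\<lambda>z. qpoch q q (Suc n) / qpoch a q (Suc n) * h (Suc n) z) 0"
      by (intro continuous_intros cont)
    fix z :: complex
    assume "norm z < r"
    have "h n z - h n (z * q) = z * ((1 - q ^ Suc n) * h (Suc n) z) / (1 - a * q ^ n)"
      unfolding rec[OF \<open>norm z < r\<close>] using nonzero by simp
    then have "qpoch q q n / qpoch a q n * (h n z - h n (z * q)) =
        qpoch q q n / qpoch a q n * (z * ((1 - q ^ Suc n) * h (Suc n) z) / (1 - a * q ^ n))"
      by simp
    then show "qpoch q q n / qpoch a q n * h n z - qpoch q q n / qpoch a q n * h n (z * q) =
        z * (qpoch q q (Suc n) / qpoch a q (Suc n) * h (Suc n) z)"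
      unfolding Suc_a Suc_q right_diff_distrib[symmetric] by (simp add: mult_ac del: power_Suc)
  qed
  finally show ?case .
qed

text \<open>Both sides of the functional equation are expanded in powers of \<open>b\<close>, and
  the coefficients of \<open>b ^ Suc n\<close> are compared.\<close>

lemma coeff_recurrence:
  fixes h :: "nat \<Rightarrow> complex \<Rightarrow> complex"
  assumes "norm q < 1" and "r > 0" and c: "norm c < r"
    and sums: "\<And>b z. norm b < r \<Longrightarrow> norm z < r \<Longrightarrow> (\<lambda>n. h n z * b ^ n) sums f b z"
    and eq: "\<And>b. norm b < r \<Longrightarrow>
      c * (f b c - f (b * q) c) =
      b * (f b c - f b (c * q) - a * f (b * q) c + a * f (b * q) (c * q))"
  shows "c * ((1 - q ^ Suc n) * h (Suc n) c) = (1 - a * q ^ n) * (h n c - h n (c * q))"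
proof -
  define v where "v n = (1 - a * q ^ n) * (h n c - h n (c * q))" for n
  \<comment> \<open>The coefficient of \<open>b ^ n\<close> in left side minus right side; the
    \<open>case\<close> records the shift by one caused by the factor \<open>b\<close> on the
    right.\<close>
  define u where "u n = c * ((1 - q ^ n) * h n c) - (case n of 0 \<Rightarrow> 0 | Suc m \<Rightarrow> v m)" for n
  have "(\<lambda>n. u n * b ^ n) sums 0" if b: "norm b < r" for b
  proof -
    note less = norm_mult_less_left[OF _ \<open>norm q < 1\<close>]
    note s = sums[OF b c] sums[OF less[OF b] c] sums[OF b less[OF c]]
      sums[OF less[OF b] less[OF c]]
    have lhs: "(\<lambda>n. c * (h n c * b ^ n - h n c * (b * q) ^ n)) sums (c * (f b c - f (b * q) c))"
      by (intro sums_mult sums_diff s)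
    have "(\<lambda>n. b * (h n c * b ^ n - h n (c * q) * b ^ n - a * (h n c * (b * q) ^ n)
        + a * (h n (c * q) * (b * q) ^ n))) sums
        (b * (f b c - f b (c * q) - a * f (b * q) c + a * f (b * q) (c * q)))"
      by (intro sums_mult sums_diff sums_add s)
    \<comment> \<open>Replacing \<open>b\<close> by \<open>b * q\<close> multiplies the coefficient
      of \<open>b ^ n\<close> by \<open>q ^ n\<close>, so the four terms factor as
      \<open>v n\<close>.\<close>
    then have "(\<lambda>n. v n * b ^ Suc n) sums (c * (f b c - f (b * q) c))"
      unfolding eq[OF b] by (simp add: v_def algebra_simps power_mult_distrib)
    then have "(\<lambda>n. (case n of 0 \<Rightarrow> 0 | Suc m \<Rightarrow> v m) * b ^ n) sums (c * (f b c - f (b * q) c))"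
      by (subst sums_Suc_iff[symmetric, where f = "\<lambda>n. (case n of 0 \<Rightarrow> 0 | Suc m \<Rightarrow> v m) * b ^ n",
            simplified]) simp
    from sums_diff[OF lhs this] show ?thesis
      by (simp add: u_def algebra_simps power_mult_distrib)
  qed
  from powser_sums_0_imp_coeff_0[OF \<open>r > 0\<close> this, where n = "Suc n"] show ?thesis
    by (simp add: u_def v_def)
qed

theorem theorem2p1:
  fixes q :: complex
    and f :: "complex \<Rightarrow> complex \<Rightarrow> complex \<Rightarrow> complex"
    and U :: "(complex \<times> complex \<times> complex) set"
  assumes "0 < norm q" and "norm q < 1"
    and "open U" and "(0, 0, 0) \<in> U"
    and "analytic3_on f U"
    and "\<And>a b c. (a, b, c) \<in> U \<Longrightarrow> (a, b * q, c) \<in> U \<Longrightarrow> (a, b, c * q) \<in> U \<Longrightarrow>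
           (a, b * q, c * q) \<in> U \<Longrightarrow>
           c * (f a b c - f a (b * q) c) =
           b * (f a b c - f a b (c * q) - a * f a (b * q) c + a * f a (b * q) (c * q))"
  shows "\<forall>\<^sub>F (a, b, c) in nhds (0, 0, 0).
           f a b c = T_op q a b (\<lambda>z. f a 0 z) c \<and>
           (\<lambda>n. qpoch a q n / qpoch q q n * b ^ n * (Dq q ^^ n) (\<lambda>z. f a 0 z) c) sums f a b c"
proof -
  obtain r0 A where "r0 > 0" and A: "\<And>a b c. norm a < r0 \<Longrightarrow> norm b < r0 \<Longrightarrow> norm c < r0 \<Longrightarrow>
      ((\<lambda>(i, j, k). A i j k * a ^ i * b ^ j * c ^ k) has_sum f a b c) UNIV"
    using assms(4,5) unfolding analytic3_on_def by fastforce
  obtain e where "e > 0" and e: "ball (0, 0, 0) e \<subseteq> U"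
    using assms(3,4) openE by blast
  \<comment> \<open>The bound 1 gives \<open>norm a < 1\<close>, \<open>r0\<close> keeps the triple
    series valid, and \<open>e / 3\<close> puts the polydisc inside the ball of radius
    \<open>e\<close>.\<close>
  define r where "r = min 1 (min r0 (e / 3))"
  have r: "r > 0" "r \<le> 1" "r \<le> r0" "3 * r \<le> e"
    using \<open>r0 > 0\<close> \<open>e > 0\<close> by (auto simp: r_def)
  have U: "(a, b, c) \<in> U" if "norm a < r" "norm b < r" "norm c < r" for a b c
  proof -
    have "norm (a, b, c) \<le> norm a + (norm b + norm c)"
      using norm_Pair_le[of a "(b, c)"] norm_Pair_le[of b c] by linarith
    then have "norm (a, b, c) < e"
      using that r by linarith
    then show ?thesis
      using e by (auto simp: dist_norm zero_prod_def[symmetric])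
  qed
  have expansion: "(\<lambda>n. qpoch a q n / qpoch q q n * b ^ n * (Dq q ^^ n) (\<lambda>z. f a 0 z) c)
      sums f a b c" if abc: "norm a < r" "norm b < r" "norm c < r" for a b c
  proof -
    have "((\<lambda>(i, j, k). A i j k * a ^ i * b ^ j * c ^ k) has_sum f a b c) UNIV"
      if "norm b < r" "norm c < r" for b c
      using A abc(1) that r by simp
    then obtain g where g: "\<And>j c. norm c < r \<Longrightarrow> summable (\<lambda>k. g j k * c ^ k)"
      "\<And>b c. norm b < r \<Longrightarrow> norm c < r \<Longrightarrow> (\<lambda>j. (\<Sum>k. g j k * c ^ k) * b ^ j) sums f a b c"
      using has_sum_triple_power_series_slice[OF r(1) abc(1), of A "f a"] by blast
    define h where "h j z = (\<Sum>k. g j k * z ^ k)" for j z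
    have sums: "(\<lambda>j. h j z * b ^ j) sums f a b z" if "norm b < r" "norm z < r" for b z
      using g(2)[OF that] by (simp add: h_def)
    \<comment> \<open>A power series that converges at the nonzero point \<open>r / 2\<close> is
      continuous at 0.\<close>
    have cont: "isCont (h j) 0" for j
    proof -
      have "summable (\<lambda>k. g j k * (of_real (r / 2) :: complex) ^ k)"
        using r by (intro g(1)) simp
      then show ?thesis
        unfolding h_def using r by (intro isCont_powser[of _ "of_real (r / 2)"]) auto
    qed
    note less = norm_mult_less_left[OF _ assms(2)]
    have rec: "z * ((1 - q ^ Suc n) * h (Suc n) z) = (1 - a * q ^ n) * (h n z - h n (z * q))"
      if z: "norm z < r" for n z
      \<comment> \<open>Multiplying a coordinate by \<open>q\<close> stays in the polydisc, so all
        four points required by the functional equation lie in \<open>U\<close>.\<close>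
      by (rule coeff_recurrence[OF assms(2) r(1) z sums])
        (assumption | intro assms(6) U abc(1) z less)+
    \<comment> \<open>At \<open>b = 0\<close> only the term with index 0 survives.\<close>
    have zero: "f a 0 z = h 0 z" if "norm z < r" for z
      using sums[of 0 z] r(1) that powser_sums_zero_iff[of "\<lambda>j. h j z"] by simp
    have "norm a < 1"
      using abc(1) r by simp
    have "(Dq q ^^ n) (\<lambda>z. f a 0 z) c = qpoch q q n / qpoch a q n * h n c" for n
      using assms(2) \<open>norm a < 1\<close> abc(3) cont rec zero by (rule Dq_power_eq_coeff)
    then have "qpoch a q n / qpoch q q n * b ^ n * (Dq q ^^ n) (\<lambda>z. f a 0 z) c = h n c * b ^ n" for n
      using qpoch_nonzero[OF \<open>norm a < 1\<close> assms(2), of n] qpoch_nonzero[OF assms(2,2), of n] by simp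
    then show ?thesis
      using sums[OF abc(2,3)] by simp
  qed
  have "\<forall>\<^sub>F p in nhds (0, 0, 0). p \<in>
      ball (0 :: complex) r \<times> ball (0 :: complex) r \<times> ball (0 :: complex) r"
    using r by (intro eventually_nhds_in_open open_Times) auto
  then show ?thesis
    by eventually_elim (use expansion in \<open>auto simp: T_op_def intro: sums_unique simp del: times_divide_eq_left\<close>)
qed

end
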